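(* Let $p\ge 3$ be a prime. Then the permutation of $\mathbb{F}_p$ induced by the polynomial $D_2(1,x)+x$ has cycle type $\bigl(\underbrace{2,\dots,2}_{\frac{p-1}{2}\text{ times}},1\bigr)$.
   Context: The $n$th reversed Dickson polynomial of the first kind (with parameter $1$) is the integer-coefficient polynomial $D_n(1,x)$ defined by $D_0(1,x)=2$, $D_1(1,x)=1$, $D_n(1,x)=D_{n-1}(1,x)-x\,D_{n-2}(1,x)$ for $n\ge 2$. Coefficients are reduced modulo $p$ to regard it as a polynomial over $\mathbb{F}_p$. The cycle type of a permutation of $\mathbb{F}_p$ is the multiset of lengths of the cycles in its disjoint cycle decomposition, fixed points being counted as cycles of length $1$. *)

theory Defs
  imports
    "Berlekamp_Zassenhaus.Finite_Field"
    "HOL-Combinatorics.Orbits"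
    "HOL-Library.Multiset"
begin

fun rev_dickson :: "nat \<Rightarrow> int poly" where
  "rev_dickson 0 = [:2:]"
| "rev_dickson (Suc 0) = [:1:]"
| "rev_dickson (Suc (Suc n)) = rev_dickson (Suc n) - [:0, 1:] * rev_dickson n"

text \<open>
  The prime field with $p$ elements is \<^typ>\<open>'p mod_ring\<close> with \<^term>\<open>CARD('p::prime_card) = p\<close>;
  on this type \<^const>\<open>of_int\<close> is reduction modulo $p$.
\<close>

definition induced_map :: "int poly \<Rightarrow> 'p::prime_card mod_ring \<Rightarrow> 'p mod_ring" where
  "induced_map f = poly (of_int_poly f)"

text \<open>
  The orbits of a permutation of a finite type are the supports of its cycles. As
  \<^term>\<open>range (orbit f)\<close> is a set, each cycle is counted once; a fixed point contributes
  a singleton orbit, that is, a cycle of length 1.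
\<close>

definition cycle_type :: "('a::finite \<Rightarrow> 'a) \<Rightarrow> nat multiset" where
  "cycle_type f = image_mset card (mset_set (range (orbit f)))"

end

theory Submission
  imports Defs
begin

text \<open>Since D_2(1,x) = 1 - 2x, the polynomial induces x \<mapsto> 1 - x
  (\<open>induced_map_rev_dickson_2\<close>). This reflection is an involution, hence bijective, and
  as p is odd its only fixed point is 1/2. The other p - 1 elements therefore fall into 2-cycles {x,
  1 - x}; \<open>cycle_type_involution\<close> does this count for any involution with one fixed
  point.\<close>

lemma orbit_involution:
  assumes "\<And>x. f (f x) = x"
  shows "orbit f x = {x, f x}"
proof
  show "orbit f x \<subseteq> {x, f x}"
  proof
    fix y assume "y \<in> orbit f x"
    then show "y \<in> {x, f x}" by induction (auto simp: assms)
  qed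
  have "f x \<in> orbit f x" by (rule orbit.base)
  \<comment> \<open>\<open>orbit f x\<close> is generated from \<open>f x\<close>, not from
    \<open>x\<close>; the point \<open>x\<close> is recovered as \<open>f (f x)\<close>.\<close>
  moreover from this have "f (f x) \<in> orbit f x" by (rule orbit.step)
  ultimately show "{x, f x} \<subseteq> orbit f x" by (simp add: assms)
qed

text \<open>The orbits other than {a} form a partition \<open>B\<close> of the complement of
  \<open>a\<close> into pairs, so counting elements gives
  \<open>2 * card B = CARD('a) - 1\<close>.\<close>

lemma cycle_type_involution:
  fixes f :: "'a::finite \<Rightarrow> 'a"
  assumes inv: "\<And>x. f (f x) = x" and fix_iff: "\<And>x. f x = x \<longleftrightarrow> x = a"
  shows "cycle_type f = replicate_mset ((CARD('a) - 1) div 2) 2 + {#1#}"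
proof -
  define B where "B = orbit f ` (UNIV - {a})"
  have orbit: "orbit f x = {x, f x}" for x
    using inv by (rule orbit_involution)
  have two: "card c = 2" if "c \<in> B" for c
  proof -
    obtain x where "x \<noteq> a" "c = {x, f x}"
      using \<open>c \<in> B\<close> unfolding B_def orbit by blast
    moreover from this have "f x \<noteq> x"
      by (simp add: fix_iff)
    ultimately show ?thesis
      by simp
  qed
  \<comment> \<open>Any element of a block determines the block, so blocks that meet are
    equal.\<close>
  have block: "c = {z, f z}" if "c \<in> B" "z \<in> c" for c z
    using that inv by (auto simp: B_def orbit)
  \<comment> \<open>No other point is sent to \<open>a\<close>, so no block of \<open>B\<close>
    contains \<open>a\<close>.\<close>
  have a_iff: "a = f x \<longleftrightarrow> x = a" for x
    by (metis inv fix_iff)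
  have "\<Union>B = UNIV - {a}"
    by (auto simp: B_def orbit a_iff)
  moreover have "2 * card B = card (\<Union>B)"
  proof (rule card_partition)
    show "c1 \<inter> c2 = {}" if "c1 \<in> B" "c2 \<in> B" "c1 \<noteq> c2" for c1 c2
      using that block by blast
  qed (simp_all add: two)
  ultimately have card_B: "card B = (CARD('a) - 1) div 2"
    by simp
  have "orbit f a = {a}"
    using fix_iff by (simp add: orbit)
  then have "range (orbit f) = insert {a} B"
    unfolding B_def by (metis UNIV_I image_insert insert_Diff)
  \<comment> \<open>As {a} is not in \<open>B\<close>, inserting it adds one new element to the
    multiset, namely the cycle length 1.\<close>
  moreover have "{a} \<notin> B"
    using two by force
  moreover have "image_mset card (mset_set B) = replicate_mset (card B) 2"
  proof -
    have "image_mset card (mset_set B) = image_mset (\<lambda>_. 2) (mset_set B)"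
      by (rule image_mset_cong) (simp add: two)
    then show ?thesis
      by (simp add: image_mset_const_eq)
  qed
  ultimately show ?thesis
    by (simp add: cycle_type_def card_B)
qed

lemma two_neq_zero_mod_ring:
  assumes "CARD('p::prime_card) \<ge> 3"
  shows "(2 :: 'p mod_ring) \<noteq> 0"
proof
  assume "(2 :: 'p mod_ring) = 0"
  then have "of_nat 2 = (0 :: 'p mod_ring)" by simp
  then have "CARD('p) dvd 2" by (simp only: of_nat_eq_0_iff_char_dvd semiring_char_mod_ring)
  with assms show False by (auto dest: dvd_imp_le)
qed

lemma induced_map_rev_dickson_2:
  "induced_map (rev_dickson 2 + [:0, 1:]) x = 1 - x"
  by (simp add: induced_map_def numeral_2_eq_2 of_int_hom.map_poly_hom_add)

theorem theorem3p12:
  fixes p :: nat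
    and f :: "'p::prime_card mod_ring \<Rightarrow> 'p mod_ring"
  assumes "prime p" and "p \<ge> 3" and "CARD('p) = p"
  defines "f \<equiv> induced_map (rev_dickson 2 + [:0, 1:])"
  shows "f permutes UNIV \<and> cycle_type f = replicate_mset ((p - 1) div 2) 2 + {#1#}"
proof
  have f: "f x = 1 - x" for x
    by (simp add: f_def induced_map_rev_dickson_2)
  then have inv: "f (f x) = x" for x
    by simp
  show "f permutes UNIV"
    unfolding permutes_def by (metis UNIV_I inv)
  have "(2 :: 'p mod_ring) \<noteq> 0"
    using assms by (intro two_neq_zero_mod_ring) simp
  \<comment> \<open>1 - x = x means 2x = 1, which has the unique solution 1/2 because 2 is
    invertible.\<close>
  then have "f x = x \<longleftrightarrow> x = 1 / 2" for x
    by (auto simp: f field_simps)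
  from cycle_type_involution[of f, OF inv this]
  show "cycle_type f = replicate_mset ((p - 1) div 2) 2 + {#1#}"
    using assms(3) by simp
qed

end
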